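(* Let $G=\{g_1:=0,g_2,\ldots,g_n\}$ be a finite Abelian group of even order $n\ge 4$ which is not isomorphic to $(\mathbb{Z}/2\mathbb{Z})^\nu$ for any $\nu$, and let $$L_G=\Big\{{\boldsymbol x}=(x_1,\ldots,x_n)\in\mathbb{Z}^n:\ \sum_{i=1}^n x_i=0,\ \sum_{j=2}^n x_j g_j=0\Big\}.$$ Then $L_G$ is not strongly eutactic.
   Context: For a lattice $\Lambda$ let $|\Lambda|$ be its minimal nonzero Euclidean norm and $S(\Lambda)$ its set of vectors of norm $|\Lambda|$. $\Lambda$ is strongly eutactic (in $V=\operatorname{span}_{\mathbb R}\Lambda$) if $\frac{1}{|\Lambda|}S(\Lambda)$ is a spherical $2$-design in $V$, i.e. the average over the unit sphere of $V$ of every real polynomial of degree $\le 2$ equals its average over this finite set; equivalently, $\sum_{{\boldsymbol x}\in S(\Lambda)}({\boldsymbol x},{\boldsymbol y})^2=\frac{|\Lambda|^2|S(\Lambda)|}{\dim V}({\boldsymbol y},{\boldsymbol y})$ for all ${\boldsymbol y}\in V$. *)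

theory Defs
  imports
    "HOL-Algebra.FiniteProduct"
    "HOL-Algebra.Product_Groups"
    "HOL-Probability.Probability_Measure"
    "HOL-Analysis.Analysis"
begin

text \<open>The library has no surface measure on the unit sphere of a subspace \<open>V\<close>.  We obtain the
  uniform probability measure on it as the law of the direction of the orthogonal projection
  to \<open>V\<close> (on a subspace this is \<^const>\<open>closest_point\<close>) of a uniformly distributed point of the
  unit ball.  The lemmas below show that for \<open>V \<noteq> {0}\<close> it is a Borel probability measure,
  concentrated on the unit sphere of \<open>V\<close> and invariant under the linear isometries of \<open>V\<close> (each
  of them extends to an orthogonal transformation of the whole space that preserves \<open>V\<close>); these
  properties determine normalized surface measure.  For \<open>V = {0}\<close> the sphere is empty and the
  definition is meaningless.\<close>

definition sphere_measure :: "'a::euclidean_space set \<Rightarrow> 'a measure" where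
  "sphere_measure V =
     distr (uniform_measure lborel (ball 0 1)) borel
       (\<lambda>x. closest_point V x /\<^sub>R norm (closest_point V x))"

text \<open>Functions on \<open>\<real>\<^sup>n\<close> given by real polynomials of total degree at most \<open>t\<close>; \<open>e\<close> runs over the
  (finitely many) exponent vectors.\<close>

definition poly_fun_degree_le :: "nat \<Rightarrow> (real^'n \<Rightarrow> real) \<Rightarrow> bool" where
  "poly_fun_degree_le t p \<longleftrightarrow>
     (\<exists>c :: ('n \<Rightarrow> nat) \<Rightarrow> real. \<forall>x.
        p x = (\<Sum>e | (\<Sum>i\<in>UNIV. e i) \<le> t. c e * (\<Prod>i\<in>UNIV. (x $ i) ^ e i)))"

text \<open>Polynomials on \<open>V\<close> are the restrictions of polynomials on \<open>\<real>\<^sup>n\<close>, with the same degree bound.\<close>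

definition spherical_design :: "nat \<Rightarrow> (real^'n) set \<Rightarrow> (real^'n) set \<Rightarrow> bool" where
  "spherical_design t V X \<longleftrightarrow>
     finite X \<and> X \<noteq> {} \<and> X \<subseteq> V \<inter> sphere 0 1 \<and>
     (\<forall>p. poly_fun_degree_le t p \<longrightarrow>
        (\<integral>x. p x \<partial>sphere_measure V) = (\<Sum>x\<in>X. p x) / real (card X))"

definition min_norm :: "'a::euclidean_space set \<Rightarrow> real" where
  "min_norm \<Lambda> = Inf (norm ` (\<Lambda> - {0}))"

definition min_vectors :: "'a::euclidean_space set \<Rightarrow> 'a set" where
  "min_vectors \<Lambda> = {x \<in> \<Lambda>. norm x = min_norm \<Lambda>}"

definition strongly_eutactic :: "(real^'n) set \<Rightarrow> bool" where
  "strongly_eutactic \<Lambda> \<longleftrightarrow>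
     spherical_design 2 (span \<Lambda>) ((\<lambda>x. x /\<^sub>R min_norm \<Lambda>) ` min_vectors \<Lambda>)"

text \<open>The group is written multiplicatively, \<open>g\<close> enumerates its elements, and \<open>i1\<close> is the index
  of the neutral element (the index \<open>1\<close> of \<open>g\<^sub>1 = 0\<close>).\<close>

definition group_lattice ::
    "('g, 'b) monoid_scheme \<Rightarrow> ('n::finite \<Rightarrow> 'g) \<Rightarrow> 'n \<Rightarrow> (real^'n) set" where
  "group_lattice G g i1 =
     {(\<chi> i. real_of_int (z i)) | z :: 'n \<Rightarrow> int.
        (\<Sum>i\<in>UNIV. z i) = 0 \<and>
        (\<Otimes>\<^bsub>G\<^esub>j\<in>UNIV - {i1}. g j [^]\<^bsub>G\<^esub> z j) = \<one>\<^bsub>G\<^esub>}"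

lemma finite_exponents: "finite {e :: 'n::finite \<Rightarrow> nat. (\<Sum>i\<in>UNIV. e i) \<le> t}"
proof (rule finite_subset)
  show "{e :: 'n \<Rightarrow> nat. (\<Sum>i\<in>UNIV. e i) \<le> t} \<subseteq> (\<Pi>\<^sub>E i\<in>UNIV. {..t})"
  proof
    fix e :: "'n \<Rightarrow> nat" assume e: "e \<in> {e. (\<Sum>i\<in>UNIV. e i) \<le> t}"
    have "e i \<le> t" for i
      using e member_le_sum[of i UNIV e] by simp
    then show "e \<in> (\<Pi>\<^sub>E i\<in>UNIV. {..t})" by auto
  qed
  show "finite (\<Pi>\<^sub>E i\<in>(UNIV :: 'n set). {..t})"
    by (intro finite_PiE) auto
qed

lemma sphere_proj_measurable:
  fixes V :: "'a::euclidean_space set"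
  assumes "subspace V"
  shows "(\<lambda>x. closest_point V x /\<^sub>R norm (closest_point V x)) \<in> borel_measurable borel"
proof -
  have "continuous_on UNIV (closest_point V)"
    using assms by (intro continuous_on_closest_point)
      (auto simp: closed_subspace subspace_imp_convex subspace_0 dest: subspace_0)
  then have "closest_point V \<in> borel_measurable borel"
    by (rule borel_measurable_continuous_onI)
  then show ?thesis by measurable
qed

lemma emeasure_unit_ball:
  "emeasure lborel (ball (0::'a::euclidean_space) 1) \<noteq> 0"
  "emeasure lborel (ball (0::'a::euclidean_space) 1) \<noteq> \<infinity>"
proof -
  show "emeasure lborel (ball (0::'a) 1) \<noteq> \<infinity>"
    using emeasure_lborel_ball_finite[of 0 1] by (simp add: less_top)
  have "\<not> negligible (ball (0::'a) 1)"
    by (simp add: open_not_negligible)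
  then show "emeasure lborel (ball (0::'a) 1) \<noteq> 0"
    by (auto simp: negligible_iff_emeasure0)
qed

lemma prob_space_sphere_measure:
  fixes V :: "'a::euclidean_space set"
  assumes "subspace V"
  shows "prob_space (sphere_measure V)"
  unfolding sphere_measure_def
proof (rule prob_space.prob_space_distr)
  show "prob_space (uniform_measure lborel (ball (0::'a) 1))"
    by (rule prob_space_uniform_measure) (rule emeasure_unit_ball)+
  show "(\<lambda>x. closest_point V x /\<^sub>R norm (closest_point V x))
      \<in> uniform_measure lborel (ball 0 1) \<rightarrow>\<^sub>M borel"
    using sphere_proj_measurable[OF assms] by simp
qed

lemma closest_point_subspace_orth:
  fixes V :: "'a::euclidean_space set"
  assumes V: "subspace V" and "v \<in> V"
  shows "(x - closest_point V x) \<bullet> v = 0"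
proof -
  have cl: "convex V" "closed V" "V \<noteq> {}"
    using V by (auto simp: closed_subspace subspace_imp_convex dest: subspace_0)
  let ?p = "closest_point V x"
  have p: "?p \<in> V" using cl by (simp add: closest_point_in_set)
  have "(x - ?p) \<bullet> ((?p + v) - ?p) \<le> 0" "(x - ?p) \<bullet> ((?p - v) - ?p) \<le> 0"
    using cl(1,2) p assms by (intro closest_point_dot; simp add: subspace_add subspace_diff)+
  then show ?thesis by simp
qed

lemma AE_sphere_measure:
  fixes V :: "'a::euclidean_space set"
  assumes V: "subspace V" and nz: "V \<noteq> {0}"
  shows "AE x in sphere_measure V. x \<in> V \<inter> sphere 0 1"
proof -
  obtain v where v: "v \<in> V" "v \<noteq> 0" using V nz subspace_0 by fastforce
  have cl: "convex V" "closed V" "V \<noteq> {}"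
    using V by (auto simp: closed_subspace subspace_imp_convex dest: subspace_0)
  have "negligible {x. v \<bullet> x = 0}" using v by (simp add: negligible_hyperplane)
  then have "AE x in lebesgue. v \<bullet> x \<noteq> 0"
    by (auto simp: negligible_iff_null_sets dest!: AE_not_in)
  then have "AE x in lborel. v \<bullet> x \<noteq> 0"
    by (simp add: AE_completion_iff)
  then have ae: "AE x in uniform_measure lborel (ball 0 1). v \<bullet> x \<noteq> 0"
    by (intro AE_uniform_measureI) auto
  have imp: "closest_point V x /\<^sub>R norm (closest_point V x) \<in> V \<inter> sphere 0 1" if "v \<bullet> x \<noteq> 0" for x
  proof -
    have "closest_point V x \<noteq> 0"
      using closest_point_subspace_orth[OF V v(1), of x] that by (auto simp: inner_commute)
    moreover have "closest_point V x \<in> V" using cl by (simp add: closest_point_in_set)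
    ultimately show ?thesis using V by (auto simp: subspace_scale)
  qed
  have "closed (V \<inter> sphere 0 1)" using cl by (intro closed_Int closed_sphere)
  then have "V \<inter> sphere 0 1 \<in> sets borel" by (rule borel_closed)
  then have "{x \<in> space borel. x \<in> V \<inter> sphere 0 1} \<in> sets borel"
    by (simp only: space_borel UNIV_I simp_thms Collect_mem_eq)
  then show ?thesis
    unfolding sphere_measure_def
    using sphere_proj_measurable[OF V] ae imp
    by (subst AE_distr_iff) (auto elim!: eventually_mono)
qed

lemma closest_point_orthogonal_image:
  fixes V :: "'a::euclidean_space set"
  assumes V: "subspace V" and T: "orthogonal_transformation T" and TV: "T ` V = V"
  shows "closest_point V (T x) = T (closest_point V x)"
proof (rule closest_point_unique[symmetric])
  show cl: "convex V" "closed V"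
    using V by (auto simp: closed_subspace subspace_imp_convex)
  have ne: "V \<noteq> {}" using V subspace_0 by blast
  show "T (closest_point V x) \<in> V"
    using TV closest_point_in_set[OF cl(2) ne, of x] by blast
  show "\<forall>z\<in>V. dist (T x) (T (closest_point V x)) \<le> dist (T x) z"
  proof
    fix z assume "z \<in> V"
    then obtain w where "w \<in> V" "z = T w" using TV by blast
    then show "dist (T x) (T (closest_point V x)) \<le> dist (T x) z"
      using T closest_point_le[OF cl(2)] by (simp add: orthogonal_transformation_isometry)
  qed
qed

lemma lborel_distr_orthogonal:
  fixes T :: "'a::euclidean_space \<Rightarrow> 'a"
  assumes T: "orthogonal_transformation T"
  shows "distr lborel borel T = lborel"
proof (rule measure_eqI)
  show "sets (distr lborel borel T) = sets lborel" by simp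
  fix A assume "A \<in> sets (distr lborel borel T)"
  then have A[measurable]: "A \<in> sets borel" by simp
  have lin: "linear T" using T by (rule orthogonal_transformation_linear)
  have "continuous_on UNIV T" using lin by (simp add: linear_continuous_on linear_linear)
  then have Tm[measurable]: "T \<in> borel_measurable borel"
    by (rule borel_measurable_continuous_onI)
  define B where "B = ball (0::'a) 1"
  have [measurable]: "B \<in> sets borel" by (simp add: B_def)
  have transl: "(\<integral>\<^sup>+x. h (c + x) \<partial>lborel) = (\<integral>\<^sup>+x. h x \<partial>lborel)"
    if [measurable]: "h \<in> borel_measurable borel" for h :: "'a \<Rightarrow> ennreal" and c
    by (subst (2) lborel_distr_plus[symmetric, of c]) (simp add: nn_integral_distr)
  obtain S where S: "\<And>y. T (S y) = y"
    using orthogonal_transformation_surj[OF T] by (metis surj_def)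
  have 1: "(\<integral>\<^sup>+x. indicator A (T x + y) \<partial>lborel) = (\<integral>\<^sup>+x. indicator A (T x) \<partial>lborel)" for y
    using transl[of "\<lambda>x. indicator A (T x)" "S y"] by (simp add: linear_add[OF lin] S add.commute)
  have 2: "(\<integral>\<^sup>+x. indicator B (y - T x) \<partial>lborel) = emeasure lborel B" for y
  proof -
    have "indicator B (y - T (S y + x)) = (indicator B x :: ennreal)" for x
      using T by (simp add: linear_add[OF lin] S B_def indicator_def orthogonal_transformation_norm)
    then show ?thesis
      using transl[of "\<lambda>x. indicator B (y - T x)" "S y"] by simp
  qed
  have "emeasure lborel B * emeasure (distr lborel borel T) A =
      (\<integral>\<^sup>+y. indicator B y * (\<integral>\<^sup>+x. indicator A (T x) \<partial>lborel) \<partial>lborel)"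
  proof -
    have "emeasure (distr lborel borel T) A = (\<integral>\<^sup>+x. indicator A (T x) \<partial>lborel)"
      using nn_integral_distr[of T lborel borel "indicator A"] by simp
    then show ?thesis by (simp add: nn_integral_multc)
  qed
  also have "\<dots> = (\<integral>\<^sup>+y. (\<integral>\<^sup>+x. indicator B y * indicator A (T x + y) \<partial>lborel) \<partial>lborel)"
    by (simp add: nn_integral_cmult 1)
  also have "\<dots> = (\<integral>\<^sup>+x. (\<integral>\<^sup>+y. indicator B y * indicator A (T x + y) \<partial>lborel) \<partial>lborel)"
    by (rule lborel_pair.Fubini') measurable
  also have "\<dots> = (\<integral>\<^sup>+x. (\<integral>\<^sup>+y. indicator B (y - T x) * indicator A y \<partial>lborel) \<partial>lborel)"
  proof (rule nn_integral_cong)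
    fix x
    show "(\<integral>\<^sup>+y. indicator B y * indicator A (T x + y) \<partial>lborel) =
        (\<integral>\<^sup>+y. indicator B (y - T x) * indicator A y \<partial>lborel)"
      using transl[of "\<lambda>y. indicator B (y - T x) * indicator A y" "T x"] by simp
  qed
  also have "\<dots> = (\<integral>\<^sup>+y. (\<integral>\<^sup>+x. indicator B (y - T x) * indicator A y \<partial>lborel) \<partial>lborel)"
    by (rule lborel_pair.Fubini') measurable
  also have "\<dots> = emeasure lborel B * emeasure lborel A"
    by (simp add: nn_integral_multc nn_integral_cmult 2)
  finally show "emeasure (distr lborel borel T) A = emeasure lborel A"
    using emeasure_unit_ball[where 'a = 'a] by (simp add: ennreal_mult_cancel_left B_def)
qed

lemma sphere_measure_orthogonal:
  fixes V :: "'a::euclidean_space set"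
  assumes V: "subspace V" and T: "orthogonal_transformation T" and TV: "T ` V = V"
  shows "distr (sphere_measure V) borel T = sphere_measure V"
proof -
  let ?U = "uniform_measure lborel (ball (0::'a) 1)"
  let ?f = "\<lambda>x. closest_point V x /\<^sub>R norm (closest_point V x)"
  have lin: "linear T" using T by (rule orthogonal_transformation_linear)
  have "continuous_on UNIV T" using lin by (simp add: linear_continuous_on linear_linear)
  then have Tm[measurable]: "T \<in> borel_measurable borel"
    by (rule borel_measurable_continuous_onI)
  note [measurable] = sphere_proj_measurable[OF V]
  have U: "distr ?U borel T = ?U"
  proof (rule measure_eqI)
    fix A assume "A \<in> sets (distr ?U borel T)"
    then have [measurable]: "A \<in> sets borel" by simp
    have eq: "T -` (ball 0 1 \<inter> A) = ball 0 1 \<inter> T -` A"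
      using T by (auto simp: orthogonal_transformation_norm)
    have "emeasure lborel (ball 0 1 \<inter> A) = emeasure (distr lborel borel T) (ball 0 1 \<inter> A)"
      by (simp add: lborel_distr_orthogonal[OF T])
    also have "\<dots> = emeasure lborel (ball 0 1 \<inter> T -` A)"
      by (subst emeasure_distr) (simp_all add: eq del: vimage_Int)
    finally show "emeasure (distr ?U borel T) A = emeasure ?U A"
      using measurable_sets[OF Tm, of A] by (simp add: emeasure_distr)
  qed simp
  have comm: "T (?f x) = ?f (T x)" for x
    using closest_point_orthogonal_image[OF V T TV, of x] T
    by (simp add: linear_scale[OF lin] orthogonal_transformation_norm)
  have "distr (sphere_measure V) borel T = distr ?U borel (\<lambda>x. T (?f x))"
    unfolding sphere_measure_def by (subst distr_distr) (simp_all add: comp_def)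
  also have "\<dots> = distr ?U borel (\<lambda>x. ?f (T x))" by (simp only: comm)
  also have "\<dots> = distr (distr ?U borel T) borel ?f"
    by (subst distr_distr) (simp_all add: comp_def)
  finally show ?thesis by (simp add: U sphere_measure_def)
qed

end

theory Submission
  imports Defs "HOL-Algebra.Sylow" "HOL-Algebra.Multiplicative_Group"
begin

text \<open>The minimal vectors of \<open>L\<^sub>G\<close> are the \<open>e\<^sub>i + e\<^sub>j - e\<^sub>k - e\<^sub>l\<close> with distinct indices and
  \<open>g\<^sub>i + g\<^sub>j = g\<^sub>k + g\<^sub>l\<close>, and \<open>L\<^sub>G\<close> spans the hyperplane \<open>V\<close> of vectors with coordinate sum \<open>0\<close>.
  The mean of \<open>x\<^sub>1 x\<^sub>d\<close> over the sphere of \<open>V\<close> does not depend on \<open>d \<noteq> 1\<close>, because the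
  transpositions of coordinates preserve \<open>V\<close>; so for a strongly eutactic \<open>L\<^sub>G\<close> the sum of
  \<open>x\<^sub>1 x\<^sub>d\<close> over the minimal vectors does not depend on \<open>d\<close> either.  Counting minimal vectors by
  the signs of \<open>x\<^sub>1\<close> and \<open>x\<^sub>d\<close>, this sum is \<open>4 - n\<close> if \<open>g\<^sub>d \<notin> 2G\<close> and \<open>2g\<^sub>d \<noteq> 0\<close>, but at most
  \<open>2 - n\<close> if \<open>g\<^sub>d\<close> has order \<open>2\<close>.  Both kinds of elements exist in a group of even order that is
  not an elementary abelian \<open>2\<close>-group.\<close>

section \<open>Finite abelian groups of exponent two\<close>

text \<open>An element \<open>x\<close> outside the embedded copy of (Z/2)^k can serve as the image
  of one more generator. The new entry \<open>v k\<close> is 0 or 1, so \<open>nat\<close> is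
  harmless, and the reduction mod 2 is respected because \<open>x\<close> squares to the neutral
  element.\<close>

lemma (in comm_group) mon_product_extend:
  assumes sq: "\<And>x. x \<in> carrier G \<Longrightarrow> x \<otimes> x = \<one>"
    and f: "f \<in> mon (product_group {..<k} (\<lambda>_. integer_mod_group 2)) G"
    and x: "x \<in> carrier G" "x \<notin> f ` carrier (product_group {..<k::nat} (\<lambda>_. integer_mod_group 2))"
  shows "(\<lambda>v. f (restrict v {..<k}) \<otimes> x [^] nat (v k))
      \<in> mon (product_group {..<Suc k} (\<lambda>_. integer_mod_group 2)) G"
proof -
  let ?P = "\<lambda>k. product_group {..<k::nat} (\<lambda>_. integer_mod_group 2)"
  let ?h = "\<lambda>v::nat \<Rightarrow> int. f (restrict v {..<k}) \<otimes> x [^] nat (v k)"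
  have fh: "f \<in> hom (?P k) G" and fi: "inj_on f (carrier (?P k))"
    using f by (auto simp: mon_def)
  have fc: "f v \<in> carrier G" if "v \<in> carrier (?P k)" for v
    using fh that by (auto simp: hom_def Pi_iff)
  have res: "restrict v {..<k} \<in> carrier (?P k)" if "v \<in> carrier (?P (Suc k))" for v
    using that by (auto simp: PiE_iff)
  have two: "v k = 0 \<or> v k = 1" if "v \<in> carrier (?P (Suc k))" for v
  proof -
    have "v k \<in> {0..<2}"
      using that by (auto simp: PiE_iff carrier_integer_mod_group dest!: bspec[of _ _ k])
    then show ?thesis by auto
  qed
  have xx: "x \<otimes> (x \<otimes> y) = y" if "y \<in> carrier G" for y
    using sq[OF x(1)] x that by (simp flip: m_assoc)
  have "?h \<in> hom (?P (Suc k)) G"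
  proof (rule homI)
    fix v assume v: "v \<in> carrier (?P (Suc k))"
    then show "?h v \<in> carrier G" using fc[OF res[OF v]] x by simp
  next
    fix v w assume v: "v \<in> carrier (?P (Suc k))" and w: "w \<in> carrier (?P (Suc k))"
    have "restrict (v \<otimes>\<^bsub>?P (Suc k)\<^esub> w) {..<k} = restrict v {..<k} \<otimes>\<^bsub>?P k\<^esub> restrict w {..<k}"
      by auto
    then have r: "f (restrict (v \<otimes>\<^bsub>?P (Suc k)\<^esub> w) {..<k}) =
        f (restrict v {..<k}) \<otimes> f (restrict w {..<k})"
      using hom_mult[OF fh res[OF v] res[OF w]] by (simp only:)
    have l: "(v \<otimes>\<^bsub>?P (Suc k)\<^esub> w) k = (v k + w k) mod 2" by simp
    show "?h (v \<otimes>\<^bsub>?P (Suc k)\<^esub> w) = ?h v \<otimes> ?h w"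
      unfolding r l
      using two[OF v] two[OF w] fc[OF res[OF v]] fc[OF res[OF w]] x xx
      by (auto simp: m_ac)
  qed
  moreover have "inj_on ?h (carrier (?P (Suc k)))"
  proof (rule inj_onI)
    fix v w assume v: "v \<in> carrier (?P (Suc k))" and w: "w \<in> carrier (?P (Suc k))"
      and eq: "?h v = ?h w"
    \<comment> \<open>Multiplying the relation by \<open>f b\<close> exhibits \<open>x\<close> as
      the image of the product of \<open>b\<close> and \<open>a\<close>. This rules out that two
      vectors with equal images differ in the last coordinate.\<close>
    have img: False if a: "a \<in> carrier (?P k)" and b: "b \<in> carrier (?P k)"
      and ab: "f a = f b \<otimes> x" for a b
    proof -
      have "f (b \<otimes>\<^bsub>?P k\<^esub> a) = x"
        using hom_mult[OF fh b a] ab sq[OF fc[OF b]] fc[OF b] x by (simp flip: m_assoc)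
      moreover have "b \<otimes>\<^bsub>?P k\<^esub> a \<in> carrier (?P k)"
        by (intro monoid.m_closed group.is_monoid product_group a b) simp
      ultimately show False using x(2) by blast
    qed
    have k: "v k = w k"
      using two[OF v] two[OF w] eq img[OF res[OF v] res[OF w]] img[OF res[OF w] res[OF v]]
        fc[OF res[OF v]] fc[OF res[OF w]] x by auto
    then have "f (restrict v {..<k}) = f (restrict w {..<k})"
      using eq fc[OF res[OF v]] fc[OF res[OF w]] x by simp
    then have "restrict v {..<k} = restrict w {..<k}"
      by (rule inj_onD[OF fi _ res[OF v] res[OF w]])
    then have "v i = w i" if "i < k" for i using that by (metis restrict_apply' lessThan_iff)
    with k have "v i = w i" if "i \<in> {..<Suc k}" for i using that by (auto simp: less_Suc_eq)
    then show "v = w" using v w by (auto intro: PiE_ext)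
  qed
  ultimately show ?thesis by (simp add: mon_def)
qed

text \<open>If \<open>G\<close> were isomorphic to no power of Z/2, every embedding of a power would
  miss an element of \<open>G\<close> and could be extended, so every power would embed into the
  finite group \<open>G\<close>.\<close>

lemma (in comm_group) exponent_two_iso_product:
  assumes fin: "finite (carrier G)" and sq: "\<And>x. x \<in> carrier G \<Longrightarrow> x \<otimes> x = \<one>"
  obtains k :: nat where "G \<cong> product_group {..<k} (\<lambda>_. integer_mod_group 2)"
proof (rule ccontr)
  let ?P = "\<lambda>k. product_group {..<k::nat} (\<lambda>_. integer_mod_group 2)"
  assume "\<not> thesis"
  then have no: "\<not> G \<cong> ?P k" for k using that by blast
  have "\<exists>f. f \<in> mon (?P k) G" for k
  proof (induction k)
    case 0
    show ?case
      by (rule exI[of _ "\<lambda>_. \<one>"]) (simp add: mon_def hom_def)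
  next
    case (Suc k)
    then obtain f where f: "f \<in> mon (?P k) G" by blast
    have "f ` carrier (?P k) \<noteq> carrier G"
    proof
      assume "f ` carrier (?P k) = carrier G"
      then have "f \<in> iso (?P k) G" using f by (simp add: mon_def iso_def bij_betw_def)
      then have "?P k \<cong> G" by (rule is_isoI)
      then show False using no group.iso_sym[of "?P k" G] by simp
    qed
    moreover have "f ` carrier (?P k) \<subseteq> carrier G"
      using f by (auto simp: mon_def hom_def Pi_iff)
    ultimately obtain x where "x \<in> carrier G" "x \<notin> f ` carrier (?P k)" by blast
    from mon_product_extend[OF sq f this] show ?case by blast
  qed
  \<comment> \<open>This exponent is large enough for a contradiction, since n < 2^n.\<close>
  then obtain f where f: "f \<in> mon (?P (card (carrier G))) G" by blast
  have "card (carrier (?P (card (carrier G)))) \<le> card (carrier G)"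
    using f fin by (intro card_inj_on_le[of f]) (auto simp: mon_def hom_def Pi_iff)
  moreover have "card (carrier (?P (card (carrier G)))) = 2 ^ card (carrier G)"
    by (simp add: card_PiE carrier_integer_mod_group)
  ultimately show False by (metis leD less_exp)
qed

section \<open>Involutions and non-squares in groups of even order\<close>

text \<open>Sylow's theorem for the prime power 2^1 gives a subgroup of order 2; its nontrivial
  element is the involution.\<close>

lemma (in group) even_order_involution:
  assumes "finite (carrier G)" "even (Coset.order G)"
  obtains x where "x \<in> carrier G" "x \<noteq> \<one>" "x \<otimes> x = \<one>"
proof -
  obtain m where "Coset.order G = 2 ^ 1 * m" using assms(2) by auto
  from sylow_thm[OF two_is_prime_nat is_group this assms(1)]
  obtain H where H: "subgroup H G" "card H = 2" by auto
  have 1: "\<one> \<in> H" using H(1) by (rule subgroup.one_closed)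
  then obtain x where x: "H = {\<one>, x}" "x \<noteq> \<one>" using H(2) by (auto simp: card_2_iff)
  have xc: "x \<in> carrier G" using subgroup.subset[OF H(1)] x(1) by blast
  have "x \<otimes> x \<in> H" using subgroup.m_closed[OF H(1), of x x] x(1) by blast
  moreover have "x \<otimes> x \<noteq> x" using x(2) xc by simp
  ultimately show thesis using that xc x by blast
qed

text \<open>Squaring is not injective, hence not surjective.  If a non-square \<open>u\<close> happens to be an
  involution, multiply it by some \<open>v\<close> with \<open>v\<^sup>2 \<noteq> 1\<close>; either \<open>v\<close> or \<open>u v\<close> is a non-square.\<close>

lemma (in comm_group) nonsquare_not_involution:
  assumes fin: "finite (carrier G)" and ev: "even (Coset.order G)"
    and v: "v \<in> carrier G" "v \<otimes> v \<noteq> \<one>"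
  obtains d where "d \<in> carrier G" "d \<otimes> d \<noteq> \<one>" "\<And>k. k \<in> carrier G \<Longrightarrow> k \<otimes> k \<noteq> d"
proof -
  let ?s = "\<lambda>x. x \<otimes> x"
  obtain x where x: "x \<in> carrier G" "x \<noteq> \<one>" "x \<otimes> x = \<one>"
    using even_order_involution[OF fin ev] .
  have "\<not> inj_on ?s (carrier G)"
    using x inj_onD[of ?s "carrier G" x \<one>] by auto
  moreover have "?s ` carrier G \<subseteq> carrier G" by auto
  ultimately have "?s ` carrier G \<noteq> carrier G"
    using eq_card_imp_inj_on[OF fin, of ?s] by metis
  then obtain u where u: "u \<in> carrier G" "\<And>k. k \<in> carrier G \<Longrightarrow> k \<otimes> k \<noteq> u" by blast
  consider "u \<otimes> u \<noteq> \<one>" | "\<And>k. k \<in> carrier G \<Longrightarrow> k \<otimes> k \<noteq> v"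
    | k where "u \<otimes> u = \<one>" "k \<in> carrier G" "k \<otimes> k = v" by blast
  then show thesis
  proof cases
    case 1 then show ?thesis using that u by blast
  next
    case 2 then show ?thesis using that v by blast
  next
    case 3
    have "(u \<otimes> v) \<otimes> (u \<otimes> v) = (u \<otimes> u) \<otimes> (v \<otimes> v)" using u v by (simp add: m_ac)
    then have 1: "(u \<otimes> v) \<otimes> (u \<otimes> v) \<noteq> \<one>" using 3 v by simp
    have "l \<otimes> l \<noteq> u \<otimes> v" if l: "l \<in> carrier G" for l
    proof
      assume e: "l \<otimes> l = u \<otimes> v"
      have "(l \<otimes> inv k) \<otimes> (l \<otimes> inv k) = (l \<otimes> l) \<otimes> inv (k \<otimes> k)"
        using l 3(2) by (simp add: m_ac inv_mult)
      also have "\<dots> = u" using e 3 u v by (simp add: m_assoc)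
      finally show False using u(2) l 3(2) by simp
    qed
    then show ?thesis using that[of "u \<otimes> v"] 1 u v by simp
  qed
qed

section \<open>Short integer vectors with coordinate sum zero\<close>

text \<open>Vectors with entries -1, 0, 1 are recorded by their positive support \<open>P\<close>
  and negative support \<open>N\<close>; disjointness is assumed separately where it
  matters.\<close>

definition diff_ind :: "'n set \<Rightarrow> 'n set \<Rightarrow> 'n \<Rightarrow> int" where
  "diff_ind P N = (\<lambda>i. of_bool (i \<in> P) - of_bool (i \<in> N))"

lemma sum_of_bool_UNIV: "(\<Sum>i\<in>UNIV. of_bool (i \<in> P)) = int (card (P :: 'n::finite set))"
  by (simp add: of_bool_def sum.If_cases)

text \<open>An entry of absolute value at least 2 would use up the whole bound 4, so all other
  entries would vanish and the sum could not be 0. With entries -1, 0, 1, the zero sum forces as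
  many positive as negative ones.\<close>

lemma diff_ind_of_small_norm:
  fixes z :: "'n::finite \<Rightarrow> int"
  assumes "sum z UNIV = 0" and le: "(\<Sum>i\<in>UNIV. (z i)\<^sup>2) \<le> 4"
  obtains P N where "P \<inter> N = {}" "card P = card N" "z = diff_ind P N"
    "(\<Sum>i\<in>UNIV. (z i)\<^sup>2) = 2 * int (card P)"
proof -
  have small: "\<bar>z i\<bar> \<le> 1" for i
  proof (rule ccontr)
    assume "\<not> \<bar>z i\<bar> \<le> 1"
    then have a: "2 \<le> \<bar>z i\<bar>" by simp
    then have "2\<^sup>2 \<le> \<bar>z i\<bar>\<^sup>2" by (intro power_mono) auto
    then have "4 \<le> (z i)\<^sup>2" by simp
    moreover have "(\<Sum>i\<in>UNIV. (z i)\<^sup>2) = (z i)\<^sup>2 + (\<Sum>j\<in>UNIV - {i}. (z j)\<^sup>2)"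
      by (rule sum.remove) auto
    moreover have "0 \<le> (\<Sum>j\<in>UNIV - {i}. (z j)\<^sup>2)" by (simp add: sum_nonneg)
    ultimately have "(\<Sum>j\<in>UNIV - {i}. (z j)\<^sup>2) = 0" using le by linarith
    then have "z j = 0" if "j \<noteq> i" for j using that by (simp add: sum_nonneg_eq_0_iff)
    then have "(\<Sum>j\<in>UNIV - {i}. z j) = 0" by simp
    moreover have "sum z UNIV = z i + (\<Sum>j\<in>UNIV - {i}. z j)"
      by (rule sum.remove) auto
    ultimately show False using assms(1) a by simp
  qed
  define P where "P = {i. z i = 1}"
  define N where "N = {i. z i = -1}"
  have dj: "P \<inter> N = {}" by (auto simp: P_def N_def)
  have v: "z i = 0 \<or> z i = 1 \<or> z i = -1" for i using small[of i] by auto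
  have z: "z = diff_ind P N"
  proof
    show "z i = diff_ind P N i" for i
      using v[of i] by (auto simp: diff_ind_def P_def N_def)
  qed
  have "sum z UNIV = int (card P) - int (card N)"
    unfolding z diff_ind_def by (simp add: sum_subtractf sum_of_bool_UNIV)
  moreover have "(z i)\<^sup>2 = of_bool (i \<in> P) + of_bool (i \<in> N)" for i
    using v[of i] by (auto simp: P_def N_def)
  then have "(\<Sum>i\<in>UNIV. (z i)\<^sup>2) = int (card P) + int (card N)"
    by (simp add: sum.distrib sum_of_bool_UNIV)
  ultimately show thesis using that[OF dj _ z] assms(1) by simp
qed

lemma diff_ind_sums:
  assumes "(P :: 'n::finite set) \<inter> N = {}"
  shows "sum (diff_ind P N) UNIV = int (card P) - int (card N)"
    and "(\<Sum>i\<in>UNIV. (diff_ind P N i)\<^sup>2) = int (card P) + int (card N)"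
proof -
  show "sum (diff_ind P N) UNIV = int (card P) - int (card N)"
    unfolding diff_ind_def by (simp add: sum_subtractf sum_of_bool_UNIV)
  have "(diff_ind P N i)\<^sup>2 = of_bool (i \<in> P) + of_bool (i \<in> N)" for i
    using assms by (auto simp: diff_ind_def)
  then show "(\<Sum>i\<in>UNIV. (diff_ind P N i)\<^sup>2) = int (card P) + int (card N)"
    by (simp add: sum.distrib sum_of_bool_UNIV)
qed

section \<open>Relations in the group and those of minimal norm\<close>

locale group_enumeration = comm_group G for G (structure) +
  fixes g :: "'n::finite \<Rightarrow> 'a" and i1 :: 'n
  assumes bij: "bij_betw g UNIV (carrier G)" and g_i1: "g i1 = \<one>"
begin

lemma g_closed [simp]: "g i \<in> carrier G"
  using bij_betwE[OF bij] by blast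

lemma g_eq_iff [simp]: "g i = g j \<longleftrightarrow> i = j"
  using bij by (auto simp: bij_betw_def inj_eq)

lemma g_surj: "x \<in> carrier G \<Longrightarrow> \<exists>i. g i = x"
  using bij_betw_imp_surj_on[OF bij] by (metis imageE)

text \<open>These are the integer points of L_G. The product includes the index \<open>i1\<close>,
  whose factor is the neutral element, so that all indices are treated alike.\<close>

definition relations :: "('n \<Rightarrow> int) set" where
  "relations = {z. sum z UNIV = 0 \<and> (\<Otimes>j\<in>UNIV. g j [^] z j) = \<one>}"

text \<open>The product over \<open>N\<close> is moved to the left so that no inverses occur. The
  exponents add up to the indicator of \<open>P\<close>, even if \<open>P\<close> and
  \<open>N\<close> overlap.\<close>

lemma finprod_diff_ind:
  "(\<Otimes>j\<in>UNIV. g j [^] diff_ind P N j) \<otimes> finprod G g N = finprod G g P"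
proof -
  have ind: "(\<Otimes>j\<in>UNIV. g j [^] (of_bool (j \<in> Q) :: int)) = finprod G g Q" for Q
    by (rule finprod_mono_neutral_cong_right) auto
  have "(\<Otimes>j\<in>UNIV. g j [^] diff_ind P N j) \<otimes> (\<Otimes>j\<in>UNIV. g j [^] (of_bool (j \<in> N) :: int))
      = (\<Otimes>j\<in>UNIV. g j [^] diff_ind P N j \<otimes> g j [^] (of_bool (j \<in> N) :: int))"
    by (rule finprod_multf[symmetric]) auto
  also have "\<dots> = (\<Otimes>j\<in>UNIV. g j [^] (of_bool (j \<in> P) :: int))"
    by (simp add: diff_ind_def flip: int_pow_mult)
  finally show ?thesis by (simp only: ind)
qed

lemma diff_ind_in_relations_iff:
  assumes "P \<inter> N = {}" "card P = card N"
  shows "diff_ind P N \<in> relations \<longleftrightarrow> finprod G g P = finprod G g N"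
proof -
  have c: "finprod G g N \<in> carrier G" "(\<Otimes>j\<in>UNIV. g j [^] diff_ind P N j) \<in> carrier G" by auto
  then show ?thesis
    using finprod_diff_ind[of P N] assms by (auto simp: relations_def diff_ind_sums)
qed

lemma quad_in_relations_iff:
  assumes "i \<noteq> j" "k \<noteq> l" "{i, j} \<inter> {k, l} = {}"
  shows "diff_ind {i, j} {k, l} \<in> relations \<longleftrightarrow> g i \<otimes> g j = g k \<otimes> g l"
  using assms by (subst diff_ind_in_relations_iff) auto

text \<open>A nonzero relation of smaller norm would have one entry 1 and one entry -1, hence would
  equate two elements of the group at different indices.\<close>

lemma relations_norm_ge:
  assumes "z \<in> relations" "z \<noteq> (\<lambda>_. 0)"
  shows "4 \<le> (\<Sum>i\<in>UNIV. (z i)\<^sup>2)"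
proof (rule ccontr)
  assume "\<not> ?thesis"
  then have lt: "(\<Sum>i\<in>UNIV. (z i)\<^sup>2) < 4" by simp
  obtain P N where PN: "P \<inter> N = {}" "card P = card N" "z = diff_ind P N"
      "(\<Sum>i\<in>UNIV. (z i)\<^sup>2) = 2 * int (card P)"
    using diff_ind_of_small_norm[of z] assms(1) lt by (auto simp: relations_def)
  then consider "card P = 0" | "card P = 1" using lt by linarith
  then show False
  proof cases
    case 1
    then show False using PN assms(2) by (auto simp: diff_ind_def fun_eq_iff)
  next
    case 2
    then obtain a b where ab: "P = {a}" "N = {b}" using PN(2) by (metis card_1_singletonE)
    then have "g a = g b" using assms(1) PN by (simp add: diff_ind_in_relations_iff)
    then show False using PN(1) ab by simp
  qed
qed

text \<open>The value 4 is the lower bound of \<open>relations_norm_ge\<close>; that it is attained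
  is a separate matter, settled in \<open>min_relations_nonempty\<close>.\<close>

definition min_relations :: "('n \<Rightarrow> int) set" where
  "min_relations = {z \<in> relations. (\<Sum>i\<in>UNIV. (z i)\<^sup>2) = 4}"

lemma min_relationsE:
  assumes "z \<in> min_relations"
  obtains P N where "P \<inter> N = {}" "card P = 2" "card N = 2" "z = diff_ind P N"
    "finprod G g P = finprod G g N"
proof -
  obtain P N where PN: "P \<inter> N = {}" "card P = card N" "z = diff_ind P N"
      "(\<Sum>i\<in>UNIV. (z i)\<^sup>2) = 2 * int (card P)"
    using diff_ind_of_small_norm[of z] assms by (auto simp: min_relations_def relations_def)
  then have "card P = 2" using assms by (simp add: min_relations_def)
  with PN assms show thesis
    using that[of P N] by (auto simp: min_relations_def diff_ind_in_relations_iff)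
qed

lemma finite_min_relations: "finite min_relations"
proof (rule finite_subset)
  show "min_relations \<subseteq> (\<lambda>(P, N). diff_ind P N) ` UNIV"
    by (auto elim!: min_relationsE)
qed simp

lemma min_relations_values:
  assumes "z \<in> min_relations"
  shows "z i \<in> {-1, 0, 1}" "card {k. z k = 1} = 2" "card {k. z k = -1} = 2"
proof -
  from assms obtain P N where PN: "P \<inter> N = {}" "card P = 2" "card N = 2" "z = diff_ind P N"
    by (rule min_relationsE)
  then have "{k. z k = 1} = P" "{k. z k = -1} = N"
    by (auto simp: diff_ind_def of_bool_def split: if_splits)
  with PN show "z i \<in> {-1, 0, 1}" "card {k. z k = 1} = 2" "card {k. z k = -1} = 2"
    by (auto simp: diff_ind_def)
qed

lemma uminus_min_relations:
  assumes "z \<in> min_relations" shows "(\<lambda>i. - z i) \<in> min_relations"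
proof -
  from assms obtain P N where PN: "P \<inter> N = {}" "card P = 2" "card N = 2" "z = diff_ind P N"
      "finprod G g P = finprod G g N"
    by (rule min_relationsE)
  then have "(\<lambda>i. - z i) = diff_ind N P" by (auto simp: diff_ind_def)
  moreover have "N \<inter> P = {}" using PN by auto
  ultimately show ?thesis
    using PN diff_ind_sums[of N P] by (simp add: min_relations_def diff_ind_in_relations_iff)
qed

text \<open>Two positive entries exhaust \<open>P\<close>, and one negative entry leaves a single
  unknown index \<open>l\<close> in \<open>N\<close>.\<close>

lemma min_relation_three_coords:
  assumes z: "z \<in> min_relations" and "i \<noteq> j" "z i = 1" "z j = 1" "z k = -1"
  obtains l where "l \<noteq> k" "{i, j} \<inter> {k, l} = {}" "z = diff_ind {i, j} {k, l}"
    "g i \<otimes> g j = g k \<otimes> g l"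
proof -
  from z obtain P N where PN: "P \<inter> N = {}" "card P = 2" "card N = 2" "z = diff_ind P N"
      "finprod G g P = finprod G g N"
    by (rule min_relationsE)
  have "i \<in> P" "j \<in> P" "k \<in> N"
    using assms PN by (auto simp: diff_ind_def of_bool_def split: if_splits)
  then have P: "P = {i, j}"
    using \<open>i \<noteq> j\<close> PN(2) by (auto simp: card_2_iff)
  obtain l where N: "N = {k, l}" "l \<noteq> k"
    using \<open>k \<in> N\<close> PN(3) by (auto simp: card_2_iff)
  show thesis
    using that[of l] N P PN \<open>i \<noteq> j\<close> by simp
qed

section \<open>Counting minimal relations with prescribed signs\<close>

text \<open>The group equation determines the fourth index \<open>l\<close>, so there is at most one
  such relation. It exists if and only if the four indices are distinct: \<open>l = k\<close> is the
  excluded equation, while \<open>l = i\<close> forces \<open>k = j\<close> and \<open>l = j\<close>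
  forces \<open>k = i\<close>.\<close>

lemma card_min_relations_three_coords:
  assumes "i \<noteq> j"
  shows "card {z \<in> min_relations. z i = 1 \<and> z j = 1 \<and> z k = -1} =
    of_bool (k \<noteq> i \<and> k \<noteq> j \<and> g i \<otimes> g j \<noteq> g k \<otimes> g k)" (is "card ?S = of_bool ?c")
proof (cases ?c)
  case True
  obtain l where "g l = inv (g k) \<otimes> (g i \<otimes> g j)" using g_surj by (meson g_closed m_closed inv_closed)
  then have l: "g i \<otimes> g j = g k \<otimes> g l" by (simp flip: m_assoc)
  have ne: "l \<noteq> k" "l \<noteq> i" "l \<noteq> j"
    using True l by (auto simp: m_comm[of "g k" "g i"])
  have "?S = {diff_ind {i, j} {k, l}}"
  proof (intro equalityI subsetI)
    fix z assume "z \<in> ?S"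
    then have "z \<in> min_relations" "z i = 1" "z j = 1" "z k = -1" by auto
    then obtain l' where "z = diff_ind {i, j} {k, l'}" "g i \<otimes> g j = g k \<otimes> g l'"
      using assms by (elim min_relation_three_coords)
    moreover from this have "l' = l" using l by simp
    ultimately show "z \<in> {diff_ind {i, j} {k, l}}" by simp
  next
    fix z assume "z \<in> {diff_ind {i, j} {k, l}}"
    then have z: "z = diff_ind {i, j} {k, l}" by simp
    have dj: "{i, j} \<inter> {k, l} = {}" using True ne by auto
    have "z \<in> relations" unfolding z using assms ne dj l by (subst quad_in_relations_iff) auto
    moreover have "(\<Sum>i\<in>UNIV. (z i)\<^sup>2) = 4"
      unfolding z using assms ne dj by (subst diff_ind_sums) auto
    ultimately show "z \<in> ?S"
      using True assms ne by (simp add: min_relations_def) (auto simp: z diff_ind_def)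
  qed
  then show ?thesis using True by simp
next
  case False
  have "?S = {}"
  proof (rule ccontr)
    assume "?S \<noteq> {}"
    then obtain z where "z \<in> min_relations" "z i = 1" "z j = 1" "z k = -1" by auto
    then obtain l where "l \<noteq> k" "{i, j} \<inter> {k, l} = {}" "g i \<otimes> g j = g k \<otimes> g l"
      using assms by (elim min_relation_three_coords)
    then show False using False by auto
  qed
  then show ?thesis using False by (simp only: card.empty of_bool_eq)
qed

text \<open>Double counting of pairs of a relation \<open>z\<close> and an index \<open>k\<close>
  with \<open>z k = -1\<close>: each \<open>z\<close> has two such indices, and each
  \<open>k\<close> belongs to at most one \<open>z\<close>.\<close>

lemma card_same_sign:
  assumes "i \<noteq> j"
  shows "2 * card {z \<in> min_relations. z i = 1 \<and> z j = 1} =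
    card {k. k \<noteq> i \<and> k \<noteq> j \<and> g i \<otimes> g j \<noteq> g k \<otimes> g k}"
proof -
  have "(\<Sum>k\<in>UNIV. card {z \<in> {z \<in> min_relations. z i = 1 \<and> z j = 1}. z k = -1}) =
      2 * card {z \<in> min_relations. z i = 1 \<and> z j = 1}"
    using finite_min_relations min_relations_values
    by (intro sum_multicount) auto
  also have "(\<Sum>k\<in>UNIV. card {z \<in> {z \<in> min_relations. z i = 1 \<and> z j = 1}. z k = -1}) =
      (\<Sum>k\<in>UNIV. of_bool (k \<in> {k. k \<noteq> i \<and> k \<noteq> j \<and> g i \<otimes> g j \<noteq> g k \<otimes> g k}))"
    using card_min_relations_three_coords[OF assms] by (intro sum.cong) auto
  also have "\<dots> = card {k. k \<noteq> i \<and> k \<noteq> j \<and> g i \<otimes> g j \<noteq> g k \<otimes> g k}"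
    by (simp add: of_bool_def sum.If_cases)
  finally show ?thesis by simp
qed

text \<open>Double counting again, now with \<open>k\<close> as the second positive index of
  \<open>z\<close>.\<close>

lemma card_opposite_sign:
  assumes "i \<noteq> j"
  shows "card {z \<in> min_relations. z i = 1 \<and> z j = -1} =
    card {k. k \<noteq> i \<and> k \<noteq> j \<and> g i \<otimes> g k \<noteq> g j \<otimes> g j}"
proof -
  have one: "card {k \<in> UNIV - {i}. z k = 1} = 1" if "z \<in> min_relations" "z i = 1" for z
  proof -
    have "{k \<in> UNIV - {i}. z k = 1} = {k. z k = 1} - {i}" by auto
    then show ?thesis using min_relations_values(2)[OF that(1)] that(2) by simp
  qed
  \<comment> \<open>The index \<open>i\<close> is itself positive, so removing it leaves
    multiplicity 1.\<close>
  have "(\<Sum>k\<in>UNIV - {i}. card {z \<in> {z \<in> min_relations. z i = 1 \<and> z j = -1}. z k = 1}) =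
      1 * card {z \<in> min_relations. z i = 1 \<and> z j = -1}"
    using finite_min_relations one by (intro sum_multicount) auto
  also have "(\<Sum>k\<in>UNIV - {i}. card {z \<in> {z \<in> min_relations. z i = 1 \<and> z j = -1}. z k = 1}) =
      (\<Sum>k\<in>UNIV - {i}. of_bool (k \<in> {k. k \<noteq> j \<and> g i \<otimes> g k \<noteq> g j \<otimes> g j}))"
    using card_min_relations_three_coords[of i _ j] assms
    by (intro sum.cong) (auto simp: conj_ac)
  also have "\<dots> = card ((UNIV - {i}) \<inter> {k. k \<noteq> j \<and> g i \<otimes> g k \<noteq> g j \<otimes> g j})"
    by (simp add: of_bool_def sum.If_cases)
  also have "(UNIV - {i}) \<inter> {k. k \<noteq> j \<and> g i \<otimes> g k \<noteq> g j \<otimes> g j} =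
      {k. k \<noteq> i \<and> k \<noteq> j \<and> g i \<otimes> g k \<noteq> g j \<otimes> g j}" by auto
  finally show ?thesis by simp
qed

text \<open>Negation preserves minimal relations, so each sign pattern occurs as often as its
  opposite. Both counts therefore enter twice; the first carries no factor 2 because
  \<open>card_same_sign\<close> already gives the doubled number.\<close>

lemma moment_eq:
  assumes "i \<noteq> j"
  shows "(\<Sum>z\<in>min_relations. z i * z j) =
    int (card {k. k \<noteq> i \<and> k \<noteq> j \<and> g i \<otimes> g j \<noteq> g k \<otimes> g k}) -
    2 * int (card {k. k \<noteq> i \<and> k \<noteq> j \<and> g i \<otimes> g k \<noteq> g j \<otimes> g j})"
proof -
  let ?C = "\<lambda>s t. {z \<in> min_relations. z i = s \<and> z j = t}"
  have c: "(\<Sum>z\<in>min_relations. of_bool (z i = s \<and> z j = t)) = int (card (?C s t))" for s t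
    using finite_min_relations
    by (simp add: of_bool_def sum.If_cases Int_def conj_ac)
  have neg: "card (?C (-s) (-t)) = card (?C s t)" for s t
    by (rule bij_betw_same_card[of uminus], rule bij_betw_byWitness[of _ uminus])
      (auto simp: fun_Compl_def uminus_min_relations)
  have "z i * z j = of_bool (z i = 1 \<and> z j = 1) + of_bool (z i = -1 \<and> z j = -1)
      - of_bool (z i = 1 \<and> z j = -1) - of_bool (z i = -1 \<and> z j = 1)"
    if "z \<in> min_relations" for z
    using min_relations_values(1)[OF that, of i] min_relations_values(1)[OF that, of j] by auto
  then have "(\<Sum>z\<in>min_relations. z i * z j) =
      int (card (?C 1 1)) + int (card (?C (-1) (-1))) -
      int (card (?C 1 (-1))) - int (card (?C (-1) 1))"
    by (simp add: sum.distrib sum_subtractf c)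
  then show ?thesis
    using neg[of 1 1] neg[of 1 "-1"] card_same_sign[OF assms] card_opposite_sign[OF assms]
    by simp
qed

lemma card_UNIV_eq_order: "CARD('n) = Coset.order G"
  using bij by (simp add: Coset.order_def bij_betw_same_card)

text \<open>Since \<open>g d\<close> is not a square, the first count in \<open>moment_eq\<close> is
  n - 2. The second loses one more index \<open>e\<close>, that of the square of \<open>g d\<close>,
  and is n - 3. Finally (n - 2) - 2(n - 3) = 4 - n.\<close>

lemma moment_nonsquare:
  assumes "g d \<otimes> g d \<noteq> \<one>" "\<And>k. g k \<otimes> g k \<noteq> g d"
  shows "(\<Sum>z\<in>min_relations. z i1 * z d) = 4 - int CARD('n)"
proof -
  have d: "i1 \<noteq> d" using assms g_i1 by fastforce
  obtain e where e: "g e = g d \<otimes> g d" using g_surj by (meson g_closed m_closed)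
  have ne: "e \<noteq> i1" "e \<noteq> d" using e assms g_i1 by auto
  have "{k. k \<noteq> i1 \<and> k \<noteq> d \<and> g i1 \<otimes> g d \<noteq> g k \<otimes> g k} = UNIV - {i1, d}"
    using assms(2) g_i1 by (auto simp: eq_commute[of "g d"])
  moreover have "{k. k \<noteq> i1 \<and> k \<noteq> d \<and> g i1 \<otimes> g k \<noteq> g d \<otimes> g d} = UNIV - {i1, d, e}"
    using g_i1 by (auto simp flip: e)
  moreover have "card {i1, d, e} \<le> CARD('n)" by (rule card_mono) auto
  ultimately show ?thesis
    using moment_eq[OF d] d ne by (simp add: card_Diff_subset)
qed

text \<open>The second count in \<open>moment_eq\<close> now excludes only \<open>i1\<close> and
  \<open>d\<close>, so it is n - 2. Bounding the first by n - 2 suffices, as (n - 2) - 2(n - 2) = 2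
  - n.\<close>

lemma moment_involution:
  assumes "d \<noteq> i1" "g d \<otimes> g d = \<one>"
  shows "(\<Sum>z\<in>min_relations. z i1 * z d) \<le> 2 - int CARD('n)"
proof -
  have "g i1 \<otimes> g k \<noteq> g d \<otimes> g d \<longleftrightarrow> k \<noteq> i1" for k
    using assms(2) g_i1 g_eq_iff[of k i1] by simp
  then have "{k. k \<noteq> i1 \<and> k \<noteq> d \<and> g i1 \<otimes> g k \<noteq> g d \<otimes> g d} = UNIV - {i1, d}"
    by auto
  moreover have "card {k. k \<noteq> i1 \<and> k \<noteq> d \<and> g i1 \<otimes> g d \<noteq> g k \<otimes> g k} \<le> card (UNIV - {i1, d})"
    by (rule card_mono) auto
  moreover have "card {i1, d} \<le> CARD('n)" by (rule card_mono) auto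
  ultimately show ?thesis
    using moment_eq[of i1 d] assms(1) by (simp add: card_Diff_subset)
qed

text \<open>For any third index \<open>k\<close>, the non-square \<open>g d\<close> satisfies the
  condition of \<open>card_min_relations_three_coords\<close> with the indices \<open>i1\<close>,
  \<open>d\<close>, \<open>k\<close>.\<close>

lemma min_relations_nonempty:
  assumes "g d \<otimes> g d \<noteq> \<one>" "\<And>k. g k \<otimes> g k \<noteq> g d" "CARD('n) \<ge> 3"
  shows "min_relations \<noteq> {}"
proof -
  have d: "i1 \<noteq> d" using assms g_i1 by fastforce
  have "card {i1, d} < CARD('n)" using assms(3) d by simp
  then obtain k where "k \<notin> {i1, d}" by (metis UNIV_eq_I less_irrefl)
  then have "card {z \<in> min_relations. z i1 = 1 \<and> z d = 1 \<and> z k = -1} = 1"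
    using card_min_relations_three_coords[OF d] assms(2)[of k] g_i1 by auto
  then show ?thesis by auto
qed

end

section \<open>Second moments on the unit sphere of the sum-zero hyperplane\<close>

lemma poly_fun_coord_product: "poly_fun_degree_le 2 (\<lambda>x::real^'n. x $ a * x $ b)"
  unfolding poly_fun_degree_le_def
proof (intro exI allI)
  fix x :: "real^'n"
  \<comment> \<open>The only exponent vector with nonzero coefficient; for \<open>a = b\<close> its
    entry there is 2, so squares are covered too.\<close>
  let ?e = "\<lambda>i. of_bool (i = a) + of_bool (i = b) :: nat"
  have p: "(\<Prod>i\<in>UNIV. (x $ i) ^ of_bool (i = k)) = x $ k" for k
  proof -
    have "(x $ i) ^ of_bool (i = k) = (if i = k then x $ i else 1)" for i by simp
    then show ?thesis by simp
  qed
  have s: "(\<Sum>i\<in>UNIV. ?e i) = 2"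
    by (simp add: sum.distrib of_bool_def)
  have "(\<Sum>e | (\<Sum>i\<in>UNIV. e i) \<le> 2. of_bool (e = ?e) * (\<Prod>i\<in>UNIV. (x $ i) ^ e i)) =
      (\<Sum>e\<in>{?e}. of_bool (e = ?e) * (\<Prod>i\<in>UNIV. (x $ i) ^ e i))"
    by (rule sum.mono_neutral_right) (use finite_exponents s in auto)
  also have "\<dots> = x $ a * x $ b"
    by (simp add: power_add prod.distrib p)
  finally show "x $ a * x $ b =
      (\<Sum>e | (\<Sum>i\<in>UNIV. e i) \<le> 2. of_bool (e = ?e) * (\<Prod>i\<in>UNIV. (x $ i) ^ e i))" ..
qed

lemma orthogonal_transformation_permute_coords:
  assumes "bij p"
  shows "orthogonal_transformation (\<lambda>x::real^'n. \<chi> i. x $ p i)"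
proof -
  have "(\<Sum>i\<in>UNIV. x $ p i * y $ p i) = (\<Sum>i\<in>UNIV. x $ i * y $ i)" for x y :: "real^'n"
    by (rule sum.reindex_bij_betw[of p UNIV UNIV "\<lambda>i. x $ i * y $ i"]) (use assms in simp)
  then show ?thesis
    unfolding orthogonal_transformation_def
    by (auto intro!: linearI simp: inner_vec_def vec_eq_iff)
qed

definition sum_zero :: "(real^'n) set" where
  "sum_zero = {x. (\<Sum>i\<in>UNIV. x $ i) = 0}"

lemma subspace_sum_zero: "subspace sum_zero"
  by (auto simp: subspace_def sum_zero_def sum.distrib simp flip: sum_distrib_left)

text \<open>The transposition of coordinates \<open>b\<close> and \<open>c\<close> is orthogonal,
  preserves the hyperplane and fixes coordinate \<open>a\<close>, so invariance of the sphere
  measure exchanges the two integrands.\<close>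

lemma integral_sum_zero_sphere_coord_product:
  fixes a b c :: "'n::finite"
  assumes "a \<noteq> b" "a \<noteq> c"
  shows "(\<integral>x. x $ a * x $ b \<partial>sphere_measure sum_zero) =
    (\<integral>x. x $ a * x $ c \<partial>sphere_measure (sum_zero :: (real^'n) set))"
proof -
  let ?M = "sphere_measure (sum_zero :: (real^'n) set)"
  define T where "T = (\<lambda>x::real^'n. \<chi> i. x $ Transposition.transpose b c i)"
  have T: "orthogonal_transformation T"
    unfolding T_def by (rule orthogonal_transformation_permute_coords) simp
  have TT: "T (T x) = x" for x by (simp add: T_def vec_eq_iff)
  have "T x \<in> sum_zero" if "x \<in> sum_zero" for x
    using that sum.reindex_bij_betw[of "Transposition.transpose b c" UNIV UNIV "\<lambda>i. x $ i"]
    by (simp add: sum_zero_def T_def)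
  \<comment> \<open>\<open>T\<close> is its own inverse, so mapping the hyperplane into itself
    already makes it onto.\<close>
  then have TV: "T ` sum_zero = sum_zero"
    by (metis TT image_subsetI image_eqI subsetI subset_antisym)
  have Tm: "T \<in> borel_measurable borel"
    using orthogonal_transformation_linear[OF T]
    by (intro borel_measurable_continuous_onI linear_continuous_on) (simp add: linear_linear)
  have sets: "sets ?M = sets borel" by (simp add: sphere_measure_def)
  have "(\<integral>x. x $ a * x $ b \<partial>?M) = (\<integral>x. x $ a * x $ b \<partial>distr ?M borel T)"
    by (simp add: sphere_measure_orthogonal[OF subspace_sum_zero T TV])
  also have "\<dots> = (\<integral>x. T x $ a * T x $ b \<partial>?M)"
    by (rule integral_distr) (use Tm sets in \<open>simp_all cong: measurable_cong_sets\<close>)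
  also have "\<dots> = (\<integral>x. x $ a * x $ c \<partial>?M)"
    using assms by (simp add: T_def)
  finally show ?thesis .
qed

section \<open>Span, minimal norm and minimal vectors of the lattice\<close>

definition real_vec :: "('n \<Rightarrow> int) \<Rightarrow> real^'n" where
  "real_vec z = (\<chi> i. real_of_int (z i))"

lemma inj_real_vec: "inj real_vec"
  by (auto simp: inj_def real_vec_def vec_eq_iff fun_eq_iff)

lemma norm_real_vec: "norm (real_vec z :: real^'n::finite) = sqrt (real_of_int (\<Sum>i\<in>UNIV. (z i)\<^sup>2))"
  by (simp add: norm_vec_def L2_set_def real_vec_def)

context group_enumeration
begin

lemma group_lattice_eq: "group_lattice G g i1 = real_vec ` relations"
proof -
  have "(\<Otimes>j\<in>UNIV - {i1}. g j [^] (z j :: int)) = (\<Otimes>j\<in>UNIV. g j [^] z j)" for z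
    by (rule finprod_mono_neutral_cong_left) (auto simp: g_i1)
  then show ?thesis
    by (auto simp: group_lattice_def relations_def real_vec_def)
qed

text \<open>Every group element has trivial n-th power for n the group order, so n times the
  difference of the unit vectors at \<open>i\<close> and \<open>i1\<close> lies in the lattice.
  These differences span the hyperplane.\<close>

lemma span_group_lattice: "span (group_lattice G g i1) = sum_zero"
proof
  show "span (group_lattice G g i1) \<subseteq> sum_zero"
  proof (rule span_minimal[OF _ subspace_sum_zero])
    have "(\<Sum>i\<in>UNIV. real_of_int (z i)) = 0" if "z \<in> relations" for z
      using that by (simp add: relations_def flip: of_int_sum)
    then show "group_lattice G g i1 \<subseteq> sum_zero"
      by (auto simp: group_lattice_eq sum_zero_def real_vec_def)
  qed
next
  define n where "n = int CARD('n)"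
  have pow: "g i [^] n = \<one>" for i
    using pow_order_eq_1[of "g i"] by (simp add: n_def int_pow_int card_UNIV_eq_order)
  have mem: "axis i 1 - axis i1 1 \<in> span (group_lattice G g i1)" for i
  proof -
    define z where "z k = n * (of_bool (k = i) - of_bool (k = i1))" for k
    have "sum z UNIV = 0"
      by (simp add: z_def sum_subtractf of_bool_def flip: sum_distrib_left)
    moreover have "g k [^] z k = \<one>" for k
      by (simp add: z_def pow flip: int_pow_pow)
    ultimately have "real_vec z \<in> group_lattice G g i1"
      by (simp add: group_lattice_eq relations_def)
    then have "(1 / real_of_int n) *\<^sub>R real_vec z \<in> span (group_lattice G g i1)"
      by (intro span_scale span_base)
    also have "(1 / real_of_int n) *\<^sub>R real_vec z = axis i 1 - axis i1 1"
      by (simp add: vec_eq_iff real_vec_def z_def n_def axis_def)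
    finally show ?thesis .
  qed
  show "sum_zero \<subseteq> span (group_lattice G g i1)"
  proof
    fix x :: "real^'n" assume "x \<in> sum_zero"
    then have x: "(\<Sum>i\<in>UNIV. x $ i) = 0" by (simp add: sum_zero_def)
    have "(\<Sum>i\<in>UNIV. x $ i *\<^sub>R (axis i 1 - axis i1 1)) $ k =
        (\<Sum>i\<in>UNIV. (if i = k then x $ i else 0) - (if k = i1 then x $ i else 0))" for k
      unfolding sum_component by (rule sum.cong) (auto simp: axis_def)
    \<comment> \<open>At \<open>k = i1\<close> the subtracted part is the full coordinate sum of
      \<open>x\<close>, which is 0.\<close>
    moreover have "(\<Sum>i\<in>UNIV. (if i = k then x $ i else 0) - (if k = i1 then x $ i else 0)) = x $ k" for k
      by (cases "k = i1") (simp_all add: sum_subtractf x)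
    ultimately have "x = (\<Sum>i\<in>UNIV. x $ i *\<^sub>R (axis i 1 - axis i1 1))"
      by (simp only: vec_eq_iff simp_thms)
    moreover have "\<dots> \<in> span (group_lattice G g i1)"
      by (intro span_sum span_scale mem)
    ultimately show "x \<in> span (group_lattice G g i1)" by simp
  qed
qed

text \<open>A minimal relation attains the bound of \<open>relations_norm_ge\<close>, so the infimum
  is a minimum, equal to the square root of 4.\<close>

lemma
  assumes "min_relations \<noteq> {}"
  shows min_norm_group_lattice: "min_norm (group_lattice G g i1) = 2"
    and min_vectors_group_lattice: "min_vectors (group_lattice G g i1) = real_vec ` min_relations"
proof -
  obtain z where z: "z \<in> relations" "(\<Sum>i\<in>UNIV. (z i)\<^sup>2) = 4"
    using assms by (auto simp: min_relations_def)
  show min: "min_norm (group_lattice G g i1) = 2"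
    unfolding min_norm_def
  proof (rule cInf_eq_minimum)
    have n: "norm (real_vec z) = 2" using z by (simp add: norm_real_vec del: of_int_sum)
    then have "real_vec z \<noteq> 0" by auto
    with n z show "2 \<in> norm ` (group_lattice G g i1 - {0})"
      by (auto simp: group_lattice_eq intro!: image_eqI[of _ _ "real_vec z"])
  next
    fix r assume "r \<in> norm ` (group_lattice G g i1 - {0})"
    then obtain w where w: "w \<in> relations" "real_vec w \<noteq> 0" "r = norm (real_vec w)"
      by (auto simp: group_lattice_eq)
    then have "w \<noteq> (\<lambda>_. 0)" by (auto simp: real_vec_def vec_eq_iff)
    then have "sqrt 4 \<le> r"
      using relations_norm_ge[OF w(1)]
      unfolding w(3) norm_real_vec by (intro real_sqrt_le_mono) linarith
    then show "2 \<le> r" by simp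
  qed
  have "sqrt (real_of_int s) = 2 \<longleftrightarrow> s = 4" for s
    using real_sqrt_eq_iff[of "real_of_int s" 4] by simp
  then show "min_vectors (group_lattice G g i1) = real_vec ` min_relations"
    unfolding min_vectors_def min min_relations_def
    by (auto simp: group_lattice_eq norm_real_vec simp del: of_int_sum)
qed

text \<open>The design property turns the finite averages of the two coordinate products into sphere
  integrals, which agree by the symmetry of the hyperplane.\<close>

lemma strongly_eutactic_moments_eq:
  assumes se: "strongly_eutactic (group_lattice G g i1)" and ne: "min_relations \<noteq> {}"
    and "d \<noteq> i1" "d' \<noteq> i1"
  shows "(\<Sum>z\<in>min_relations. z i1 * z d) = (\<Sum>z\<in>min_relations. z i1 * z d')"
proof -
  define X where "X = (\<lambda>z. real_vec z /\<^sub>R 2) ` min_relations"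
  have "spherical_design 2 sum_zero X"
    using se by (simp add: strongly_eutactic_def span_group_lattice min_norm_group_lattice[OF ne]
        min_vectors_group_lattice[OF ne] image_image X_def)
  then have X: "finite X" "X \<noteq> {}"
    and integral: "(\<integral>x. x $ i1 * x $ e \<partial>sphere_measure sum_zero) =
      (\<Sum>x\<in>X. x $ i1 * x $ e) / real (card X)" for e
    using poly_fun_coord_product[of i1 e] unfolding spherical_design_def by blast+
  have "inj_on (\<lambda>z. real_vec z /\<^sub>R 2) min_relations"
    using inj_real_vec by (auto simp: inj_on_def)
  \<comment> \<open>Scaling by 1/2 is injective and contributes 1/4 to each product of two
    coordinates.\<close>
  then have S: "(\<Sum>x\<in>X. x $ i1 * x $ e) = real_of_int (\<Sum>z\<in>min_relations. z i1 * z e) / 4" for e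
    unfolding X_def
    by (simp add: sum.reindex real_vec_def sum_divide_distrib)
  have "(\<Sum>x\<in>X. x $ i1 * x $ d) / real (card X) = (\<Sum>x\<in>X. x $ i1 * x $ d') / real (card X)"
    using integral_sum_zero_sphere_coord_product[of i1 d d'] assms(3,4) by (simp add: integral)
  then have "(\<Sum>x\<in>X. x $ i1 * x $ d) = (\<Sum>x\<in>X. x $ i1 * x $ d')" using X by simp
  then have "real_of_int (\<Sum>z\<in>min_relations. z i1 * z d) =
      real_of_int (\<Sum>z\<in>min_relations. z i1 * z d')"
    unfolding S by simp
  then show ?thesis by (simp only: of_int_eq_iff)
qed

end

theorem theorem2p2:
  fixes G :: "('g, 'b) monoid_scheme"
    and g :: "'n::finite \<Rightarrow> 'g"
    and i1 :: 'n
  assumes "comm_group G"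
    and "finite (carrier G)"
    and "even (Coset.order G)"
    and "Coset.order G \<ge> 4"
    and "\<And>\<nu> :: nat. \<not> (G \<cong> product_group {..<\<nu>} (\<lambda>_. integer_mod_group 2))"
    and "bij_betw g UNIV (carrier G)"
    and "g i1 = \<one>\<^bsub>G\<^esub>"
  shows "\<not> strongly_eutactic (group_lattice G g i1)"
proof
  assume se: "strongly_eutactic (group_lattice G g i1)"
  interpret comm_group G by fact
  interpret group_enumeration G g i1
    by unfold_locales (fact assms)+
  \<comment> \<open>If all squares were trivial, \<open>G\<close> would be a power of Z/2, against
    the hypothesis.\<close>
  obtain v where v: "v \<in> carrier G" "v \<otimes>\<^bsub>G\<^esub> v \<noteq> \<one>\<^bsub>G\<^esub>"
    using exponent_two_iso_product[OF assms(2)] assms(5) by metis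
  obtain x where x: "x \<in> carrier G" "x \<otimes>\<^bsub>G\<^esub> x \<noteq> \<one>\<^bsub>G\<^esub>"
      "\<And>k. k \<in> carrier G \<Longrightarrow> k \<otimes>\<^bsub>G\<^esub> k \<noteq> x"
    using nonsquare_not_involution[OF assms(2,3) v] by blast
  obtain y where y: "y \<in> carrier G" "y \<noteq> \<one>\<^bsub>G\<^esub>" "y \<otimes>\<^bsub>G\<^esub> y = \<one>\<^bsub>G\<^esub>"
    using even_order_involution[OF assms(2,3)] by blast
  obtain d d' where d: "g d = x" and d': "g d' = y"
    using g_surj x(1) y(1) by metis
  have ne: "d \<noteq> i1" "d' \<noteq> i1" using d d' x(2) y(2) g_i1 by auto
  have sq: "g d \<otimes>\<^bsub>G\<^esub> g d \<noteq> \<one>\<^bsub>G\<^esub>" "\<And>k. g k \<otimes>\<^bsub>G\<^esub> g k \<noteq> g d"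
    using x d by auto
  have "min_relations \<noteq> {}"
    using min_relations_nonempty[OF sq] card_UNIV_eq_order assms(4) by simp
  \<comment> \<open>The two moments would have to be equal, but one is 4 - n and the other at most 2
    - n.\<close>
  from strongly_eutactic_moments_eq[OF se this ne] moment_nonsquare[OF sq]
    moment_involution[OF ne(2)] y(3) d' show False by simp
qed

end
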